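(* Let $\mathcal{H}$ be a complex Hilbert space, $A\in\mathcal{B}(\mathcal{H})$ a positive operator, and $T_1,T_2,S_1,S_2\in\mathcal{B}_{A^{1/2}}(\mathcal{H})$. Then $$r_A(T_1S_1+T_2S_2)\leq\frac12\left[\|S_1T_1\|_A+\|S_2T_2\|_A+\sqrt{\left(\|S_1T_1\|_A-\|S_2T_2\|_A\right)^2+4\|S_1T_2\|_A\|S_2T_1\|_A}\right].$$
   Context: $\mathcal{B}(\mathcal{H})$ is the algebra of bounded linear operators on the complex Hilbert space $(\mathcal{H},\langle\cdot\mid\cdot\rangle)$. For positive $A$, put $\langle x\mid y\rangle_A=\langle Ax\mid y\rangle$ and $\|x\|_A=\langle x\mid x\rangle_A^{1/2}=\|A^{1/2}x\|$. $\mathcal{B}_{A^{1/2}}(\mathcal{H})$ is the set of $T\in\mathcal{B}(\mathcal{H})$ for which there is $\lambda>0$ with $\|Tx\|_A\le\lambda\|x\|_A$ for all $x\in\mathcal{H}$ ($A$-bounded operators). For such $T$, $\|T\|_A=\sup\{\|Tx\|_A: x\in\mathcal{H},\ \|x\|_A=1\}$ (a supremum over the empty set, occurring only if $A=0$, is $0$), and the $A$-spectral radius is $r_A(T)=\inf_{n\ge1}\|T^n\|_A^{1/n}=\lim_{n\to\infty}\|T^n\|_A^{1/n}$. *)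

theory Defs
  imports "HOL-Analysis.Analysis"
begin

text \<open>
  Complex Hilbert spaces are modelled by a type class on top of the real normed spaces of the
  library, so that the norm, topology and completeness are the library's. The inner product is
  linear in its first argument.
\<close>

class complex_vector = real_vector +
  fixes scaleC :: "complex \<Rightarrow> 'a \<Rightarrow> 'a" (infixr "*\<^sub>C" 75)
  assumes scaleC_add_right: "c *\<^sub>C (x + y) = c *\<^sub>C x + c *\<^sub>C y"
    and scaleC_add_left: "(c + d) *\<^sub>C x = c *\<^sub>C x + d *\<^sub>C x"
    and scaleC_scaleC: "c *\<^sub>C (d *\<^sub>C x) = (c * d) *\<^sub>C x"
    and scaleC_one: "1 *\<^sub>C x = x"
    and scaleR_scaleC: "r *\<^sub>R x = complex_of_real r *\<^sub>C x"

class complex_inner = complex_vector + real_normed_vector +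
  fixes cinner :: "'a \<Rightarrow> 'a \<Rightarrow> complex"
  assumes cinner_commute: "cinner x y = cnj (cinner y x)"
    and cinner_add_left: "cinner (x + y) z = cinner x z + cinner y z"
    and cinner_scaleC_left: "cinner (c *\<^sub>C x) y = c * cinner x y"
    and cinner_nonneg: "cinner x x \<in> \<real>\<^sub>\<ge>\<^sub>0"
    and cinner_eq_zero_iff: "cinner x x = 0 \<longleftrightarrow> x = 0"
    and norm_eq_sqrt_cinner: "norm x = sqrt (Re (cinner x x))"

class complex_hilbert_space = complex_inner + complete_space

definition bounded_clinear :: "('a::complex_inner \<Rightarrow> 'b::complex_inner) \<Rightarrow> bool"
  where "bounded_clinear T \<longleftrightarrow> bounded_linear T \<and> (\<forall>c x. T (c *\<^sub>C x) = c *\<^sub>C T x)"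

definition positive_op :: "('a::complex_inner \<Rightarrow> 'a) \<Rightarrow> bool"
  where "positive_op A \<longleftrightarrow> bounded_clinear A \<and> (\<forall>x. cinner (A x) x \<in> \<real>\<^sub>\<ge>\<^sub>0)"

definition A_inner :: "('a::complex_inner \<Rightarrow> 'a) \<Rightarrow> 'a \<Rightarrow> 'a \<Rightarrow> complex"
  where "A_inner A x y = cinner (A x) y"

definition A_norm :: "('a::complex_inner \<Rightarrow> 'a) \<Rightarrow> 'a \<Rightarrow> real"
  where "A_norm A x = sqrt (Re (A_inner A x x))"

definition A_bounded :: "('a::complex_inner \<Rightarrow> 'a) \<Rightarrow> ('a \<Rightarrow> 'a) \<Rightarrow> bool"
  where "A_bounded A T \<longleftrightarrow>
    bounded_clinear T \<and> (\<exists>l>0. \<forall>x. A_norm A (T x) \<le> l * A_norm A x)"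

text \<open>
  The supremum of the empty set of reals is unspecified in HOL, hence the case distinction:
  for \<open>A = 0\<close> there is no vector of \<open>A\<close>-norm 1.
\<close>

definition A_opnorm :: "('a::complex_inner \<Rightarrow> 'a) \<Rightarrow> ('a \<Rightarrow> 'a) \<Rightarrow> real"
  where "A_opnorm A T =
    (if {x. A_norm A x = 1} = {} then 0 else (SUP x\<in>{x. A_norm A x = 1}. A_norm A (T x)))"

definition A_spectral_radius :: "('a::complex_inner \<Rightarrow> 'a) \<Rightarrow> ('a \<Rightarrow> 'a) \<Rightarrow> real"
  where "A_spectral_radius A T = (INF n\<in>{1..}. root n (A_opnorm A (T ^^ n)))"

end

theory Submission
  imports Defs
begin

text \<open>
  Put \<open>R = T1 S1 + T2 S2\<close>. The pair \<open>(S1 R y, S2 R y)\<close> is obtained from \<open>(S1 y, S2 y)\<close> by the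
  operator matrix with entries \<open>Si Tj\<close>, so the \<open>A\<close>-norms of \<open>(S1 R^n x, S2 R^n x)\<close> are dominated by
  iterating the nonnegative matrix \<open>M\<close> with entries \<open>\<parallel>Si Tj\<parallel>\<^sub>A\<close>. The right-hand side of the
  theorem is the Perron root of \<open>M\<close>; for every \<open>r\<close> above it there is a positive row vector \<open>w\<close>
  with \<open>w M \<le> r w\<close>, hence \<open>\<parallel>R^n\<parallel>\<^sub>A = O(r^n)\<close>.
\<close>

section \<open>The \<open>A\<close>-seminorm\<close>

text \<open>A discriminant bound: for \<open>c > 0\<close> evaluate at the minimum point
  \<open>t = - b / (2 * c)\<close>; for \<open>c = 0\<close> a nonnegative affine function is
  constant. It supplies Cauchy-Schwarz for the seminorm, which may vanish on nonzero
  vectors.\<close>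

lemma quadratic_nonneg_imp_middle_le:
  fixes a b c :: real
  assumes nonneg: "\<And>t. a + t * b + t\<^sup>2 * c \<ge> 0" and "c \<ge> 0"
  shows "b \<le> 2 * sqrt a * sqrt c"
proof -
  have "a \<ge> 0"
    using nonneg[of 0] by simp
  have "b\<^sup>2 \<le> 4 * a * c"
  proof (cases "c = 0")
    case True
    have "b = 0"
    proof (rule ccontr)
      assume "b \<noteq> 0"
      \<comment> \<open>This \<open>t\<close> makes \<open>a + t * b\<close> equal to -1.\<close>
      with nonneg[of "- (a + 1) / b"] True show False
        by simp
    qed
    with True show ?thesis
      by simp
  next
    case False
    with \<open>c \<ge> 0\<close> nonneg[of "- b / (2 * c)"] show ?thesis
      by (simp add: field_simps power2_eq_square)
  qed
  then have "b \<le> sqrt (4 * a * c)"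
    by (rule real_le_rsqrt)
  then show ?thesis
    by (simp add: real_sqrt_mult)
qed

lemma cinner_scaleR:
  "cinner (r *\<^sub>R x) y = of_real r * cinner x y"
  "cinner x (r *\<^sub>R y) = of_real r * cinner x y"
proof -
  show *: "cinner (r *\<^sub>R x) y = of_real r * cinner x y" for x y :: 'a
    by (simp add: scaleR_scaleC cinner_scaleC_left)
  show "cinner x (r *\<^sub>R y) = of_real r * cinner x y"
    by (subst (1 2) cinner_commute) (simp add: *)
qed

lemma cinner_add_right: "cinner x (y + z) = cinner x y + cinner x z"
  by (subst (1 2 3) cinner_commute) (simp add: cinner_add_left)

lemma positive_op_bounded_linear: "positive_op A \<Longrightarrow> bounded_linear A"
  by (simp add: positive_op_def bounded_clinear_def)

lemma positive_op_Re_nonneg: "positive_op A \<Longrightarrow> Re (A_inner A x x) \<ge> 0"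
  by (auto simp: positive_op_def A_inner_def complex_nonneg_Reals_iff)

lemma A_norm_nonneg: "positive_op A \<Longrightarrow> A_norm A x \<ge> 0"
  by (simp add: A_norm_def positive_op_Re_nonneg)

lemma A_inner_linear:
  assumes "positive_op A"
  shows "A_inner A (x + y) z = A_inner A x z + A_inner A y z"
    and "A_inner A x (y + z) = A_inner A x y + A_inner A x z"
    and "A_inner A (r *\<^sub>R x) y = of_real r * A_inner A x y"
    and "A_inner A x (r *\<^sub>R y) = of_real r * A_inner A x y"
proof -
  interpret bounded_linear A
    using assms by (rule positive_op_bounded_linear)
  show "A_inner A (x + y) z = A_inner A x z + A_inner A y z"
    "A_inner A x (y + z) = A_inner A x y + A_inner A x z"
    "A_inner A (r *\<^sub>R x) y = of_real r * A_inner A x y"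
    "A_inner A x (r *\<^sub>R y) = of_real r * A_inner A x y"
    by (simp_all add: A_inner_def add scaleR cinner_add_left cinner_add_right cinner_scaleR)
qed

lemma A_norm_scaleR: "positive_op A \<Longrightarrow> A_norm A (r *\<^sub>R x) = \<bar>r\<bar> * A_norm A x"
  by (simp add: A_norm_def A_inner_linear real_sqrt_mult flip: mult.assoc)

text \<open>Cauchy-Schwarz in polynomial form: \<open>?q (x + t *\<^sub>R y)\<close> is nonnegative
  for all real \<open>t\<close>, and its middle coefficient is exactly the cross term
  \<open>?b\<close> of \<open>?q (x + y)\<close>, so the bound on \<open>?b\<close> completes a
  square.\<close>

lemma A_norm_triangle:
  assumes A: "positive_op A"
  shows "A_norm A (x + y) \<le> A_norm A x + A_norm A y"
proof -
  let ?q = "\<lambda>x. Re (A_inner A x x)"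
  let ?b = "Re (A_inner A x y) + Re (A_inner A y x)"
  have "?q x + t * ?b + t\<^sup>2 * ?q y \<ge> 0" for t
    using positive_op_Re_nonneg[OF A, of "x + t *\<^sub>R y"]
    by (simp add: A_inner_linear[OF A] algebra_simps power2_eq_square)
  then have "?b \<le> 2 * sqrt (?q x) * sqrt (?q y)"
    by (rule quadratic_nonneg_imp_middle_le) (rule positive_op_Re_nonneg[OF A])
  then have "?q (x + y) \<le> (A_norm A x + A_norm A y)\<^sup>2"
    by (simp add: A_norm_def A_inner_linear[OF A] power2_sum positive_op_Re_nonneg[OF A])
  then show ?thesis
    using A_norm_nonneg[OF A] by (simp add: A_norm_def[of A "x + y"] real_le_lsqrt)
qed

section \<open>\<open>A\<close>-bounded operators and their \<open>A\<close>-norm\<close>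

lemma A_bounded_bounded_linear: "A_bounded A T \<Longrightarrow> bounded_linear T"
  by (simp add: A_bounded_def bounded_clinear_def)

lemma A_bounded_compose:
  assumes "A_bounded A S" "A_bounded A T"
  shows "A_bounded A (S \<circ> T)"
proof -
  obtain k l where k: "k > 0" "\<And>x. A_norm A (S x) \<le> k * A_norm A x"
    and l: "l > 0" "\<And>x. A_norm A (T x) \<le> l * A_norm A x"
    using assms unfolding A_bounded_def by metis
  have "A_norm A (S (T x)) \<le> (k * l) * A_norm A x" for x
    using order_trans[OF k(2) mult_left_mono[OF l(2) less_imp_le[OF k(1)]]] by (simp add: mult.assoc)
  moreover have "bounded_clinear (S \<circ> T)"
    using assms by (simp add: A_bounded_def bounded_clinear_def comp_def bounded_linear_compose)
  ultimately show ?thesis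
    unfolding A_bounded_def comp_def using k(1) l(1) mult_pos_pos by blast
qed

text \<open>The bound by \<open>K\<close> makes the supremum one over a set bounded above. It is
  stated as a bare estimate so that it also applies to powers of an operator that are controlled
  only by such an estimate.\<close>

lemma A_opnorm_nonneg:
  assumes "positive_op A" and "\<And>x. A_norm A (T x) \<le> K * A_norm A x"
  shows "A_opnorm A T \<ge> 0"
proof (cases "{x. A_norm A x = 1} = {}")
  case False
  then obtain x where x: "A_norm A x = 1"
    by blast
  have "bdd_above ((\<lambda>x. A_norm A (T x)) ` {x. A_norm A x = 1})"
    using assms(2) by (intro bdd_aboveI[of _ K]) (metis (mono_tags, lifting) imageE mem_Collect_eq mult.right_neutral)
  then have "A_norm A (T x) \<le> (SUP x\<in>{x. A_norm A x = 1}. A_norm A (T x))"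
    using x by (intro cSUP_upper) auto
  then show ?thesis
    using A_norm_nonneg[OF assms(1), of "T x"] False by (simp add: A_opnorm_def)
qed (simp add: A_opnorm_def)

lemma A_bounded_opnorm_nonneg: "positive_op A \<Longrightarrow> A_bounded A T \<Longrightarrow> A_opnorm A T \<ge> 0"
  using A_opnorm_nonneg unfolding A_bounded_def by blast

lemma A_opnorm_le:
  assumes "K \<ge> 0" and "\<And>x. A_norm A (T x) \<le> K * A_norm A x"
  shows "A_opnorm A T \<le> K"
proof (cases "{x. A_norm A x = 1} = {}")
  case False
  have "A_norm A (T x) \<le> K" if "A_norm A x = 1" for x
    using assms(2)[of x] that by simp
  with False have "(SUP x\<in>{x. A_norm A x = 1}. A_norm A (T x)) \<le> K"
    by (intro cSUP_least) auto
  with False show ?thesis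
    unfolding A_opnorm_def by (simp only: if_False)
qed (simp add: A_opnorm_def assms(1))

lemma A_norm_le_A_opnorm:
  assumes A: "positive_op A" and T: "A_bounded A T"
  shows "A_norm A (T x) \<le> A_opnorm A T * A_norm A x"
proof -
  interpret bounded_linear T
    using T by (rule A_bounded_bounded_linear)
  obtain l where l: "\<And>x. A_norm A (T x) \<le> l * A_norm A x"
    using T unfolding A_bounded_def by blast
  show ?thesis
  proof (cases "A_norm A x = 0")
    \<comment> \<open>A vector of seminorm 0 cannot be normalised, but \<open>A\<close>-boundedness
      forces \<open>T x\<close> to have seminorm 0 as well.\<close>
    case True
    with l[of x] show ?thesis
      by simp
  next
    case False
    let ?u = "(1 / A_norm A x) *\<^sub>R x"
    have u: "A_norm A ?u = 1"
      using False by (simp only: A_norm_scaleR[OF A]) (simp add: A_norm_nonneg[OF A])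
    have "bdd_above ((\<lambda>x. A_norm A (T x)) ` {x. A_norm A x = 1})"
      using l by (intro bdd_aboveI[of _ l]) (metis (mono_tags, lifting) imageE mem_Collect_eq mult.right_neutral)
    then have "A_norm A (T ?u) \<le> (SUP x\<in>{x. A_norm A x = 1}. A_norm A (T x))"
      using u by (intro cSUP_upper) auto
    moreover have "{x. A_norm A x = 1} \<noteq> {}"
      using u by blast
    ultimately have "A_norm A (T ?u) \<le> A_opnorm A T"
      unfolding A_opnorm_def by (simp only: if_False)
    moreover have "A_norm A (T ?u) = A_norm A (T x) / A_norm A x"
      by (simp only: scaleR A_norm_scaleR[OF A]) (simp add: A_norm_nonneg[OF A])
    ultimately show ?thesis
      using False A_norm_nonneg[OF A, of x] by (simp add: divide_le_eq)
  qed
qed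

section \<open>Growth of powers and the spectral radius\<close>

text \<open>The infimum lies below every term, and constants disappear under roots of growing order.
  The shift between \<open>Suc n\<close> and \<open>n\<close> costs only a factor:
  \<open>K * r ^ n = K / r * r ^ Suc n\<close>, and the root of \<open>K / r\<close> tends to
  1.\<close>

lemma A_spectral_radius_le:
  assumes A: "positive_op A" and "K > 0" "r > 0"
    and bound: "\<And>n x. A_norm A ((T ^^ Suc n) x) \<le> K * r ^ n * A_norm A x"
  shows "A_spectral_radius A T \<le> r"
proof (rule LIMSEQ_le_const)
  have nonneg: "A_opnorm A (T ^^ Suc n) \<ge> 0" for n
    using bound by (rule A_opnorm_nonneg[OF A])
  have "(\<lambda>n. root (Suc n) (K / r)) \<longlonglongrightarrow> 1"
    using LIMSEQ_root_const[of "K / r"] assms by (intro LIMSEQ_Suc) simp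
  from tendsto_mult_right[OF this, of r]
  show "(\<lambda>n. root (Suc n) (K / r) * r) \<longlonglongrightarrow> r"
    by simp
  have "A_spectral_radius A T \<le> root (Suc n) (K / r) * r" for n
  proof -
    have "bdd_below ((\<lambda>n. root n (A_opnorm A (T ^^ n))) ` {1..})"
    proof (rule bdd_belowI2)
      fix n :: nat assume "n \<in> {1..}"
      then obtain m where "n = Suc m"
        by (cases n) auto
      then show "0 \<le> root n (A_opnorm A (T ^^ n))"
        using nonneg[of m] by simp
    qed
    then have "A_spectral_radius A T \<le> root (Suc n) (A_opnorm A (T ^^ Suc n))"
      unfolding A_spectral_radius_def by (rule cINF_lower) simp
    also have "\<dots> \<le> root (Suc n) (K * r ^ n)"
      using assms by (intro real_root_le_mono A_opnorm_le) auto
    also have "K * r ^ n = K / r * r ^ Suc n"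
      using assms by simp
    also have "root (Suc n) \<dots> = root (Suc n) (K / r) * r"
      using assms by (simp only: real_root_mult real_root_power_cancel less_imp_le zero_less_Suc)
    finally show ?thesis .
  qed
  then show "\<exists>N. \<forall>n\<ge>N. A_spectral_radius A T \<le> root (Suc n) (K / r) * r"
    by blast
qed

section \<open>Nonnegative two-by-two matrices\<close>

text \<open>The lower bound on \<open>r\<close> is the larger root of
  \<open>(t - a) * (t - d) = b * c\<close>, and it is at least \<open>a\<close> and
  \<open>d\<close>. The row vector \<open>(r - d, b)\<close> gives equality in the second inequality
  and, by \<open>gap\<close>, slack in the first; since \<open>b\<close> may be 0, part of that
  slack is spent on raising \<open>b\<close> to \<open>b + e\<close>.\<close>

lemma positive_matrix_subeigenvector:
  fixes a b c d r :: real
  assumes "a \<ge> 0" "b \<ge> 0" "c \<ge> 0" "d \<ge> 0"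
    and r: "r > 1/2 * (a + d + sqrt ((a - d)\<^sup>2 + 4 * b * c))"
  obtains v w where "v > 0" "w > 0" "v * a + w * c \<le> r * v" "v * b + w * d \<le> r * w"
proof -
  let ?s = "sqrt ((a - d)\<^sup>2 + 4 * b * c)"
  have "b * c \<ge> 0"
    using assms by simp
  then have "\<bar>a - d\<bar> \<le> ?s"
    using assms by (intro real_le_rsqrt) simp
  with r have ra: "r > a" and rd: "r > d"
    by (simp_all add: abs_le_iff)
  have "?s < 2 * r - a - d"
    using r by simp
  then have "(a - d)\<^sup>2 + 4 * b * c < (2 * r - a - d)\<^sup>2"
    using power_strict_mono[of ?s "2 * r - a - d" 2] \<open>b * c \<ge> 0\<close> by (simp add: mult.assoc)
  then have gap: "b * c < (r - a) * (r - d)"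
    by (simp add: power2_eq_square algebra_simps)
  \<comment> \<open>Dividing by \<open>c + 1\<close> keeps \<open>e\<close> defined when
    \<open>c = 0\<close>, and \<open>e * c\<close> still fits into the gap.\<close>
  define e where "e = ((r - a) * (r - d) - b * c) / (c + 1)"
  have e: "e > 0"
    using gap assms by (simp add: e_def)
  have "e * (c + 1) = (r - a) * (r - d) - b * c"
    using assms by (simp add: e_def)
  then have ec: "e * c \<le> (r - a) * (r - d) - b * c"
    using e by (simp add: algebra_simps)
  show ?thesis
  proof (rule that[of "r - d" "b + e"])
    show "(r - d) * a + (b + e) * c \<le> r * (r - d)"
      using ec by (simp add: algebra_simps)
    show "(r - d) * b + (b + e) * d \<le> r * (b + e)"
      using mult_right_mono[of d r e] rd e by (simp add: algebra_simps)
  qed (use rd e assms in auto)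
qed

section \<open>The estimate for the operator sum\<close>

theorem theorem2p2:
  fixes A T1 T2 S1 S2 :: "'h::complex_hilbert_space \<Rightarrow> 'h"
  assumes "positive_op A"
    and "A_bounded A T1" and "A_bounded A T2" and "A_bounded A S1" and "A_bounded A S2"
  shows "A_spectral_radius A (\<lambda>x. (T1 \<circ> S1) x + (T2 \<circ> S2) x)
    \<le> 1/2 * (A_opnorm A (S1 \<circ> T1) + A_opnorm A (S2 \<circ> T2)
        + sqrt ((A_opnorm A (S1 \<circ> T1) - A_opnorm A (S2 \<circ> T2))\<^sup>2
            + 4 * A_opnorm A (S1 \<circ> T2) * A_opnorm A (S2 \<circ> T1)))"
proof (rule dense_ge)
  \<comment> \<open>At the Perron root itself positive weights may fail to exist, for instance if
    \<open>?b = 1\<close> and the other entries are 0; hence the passage to larger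
    \<open>r\<close>.\<close>
  fix r
  let ?N = "A_norm A"
  let ?a = "A_opnorm A (S1 \<circ> T1)" and ?b = "A_opnorm A (S1 \<circ> T2)"
  let ?c = "A_opnorm A (S2 \<circ> T1)" and ?d = "A_opnorm A (S2 \<circ> T2)"
  let ?R = "\<lambda>x. (T1 \<circ> S1) x + (T2 \<circ> S2) x"
  assume r: "1/2 * (?a + ?d + sqrt ((?a - ?d)\<^sup>2 + 4 * ?b * ?c)) < r"
  note A = assms(1)
  note bounded = A_bounded_compose[OF assms(4,2)] A_bounded_compose[OF assms(4,3)]
    A_bounded_compose[OF assms(5,2)] A_bounded_compose[OF assms(5,3)]
  note nonneg = bounded[THEN A_bounded_opnorm_nonneg[OF A]]
  note opnorm = bounded[THEN A_norm_le_A_opnorm[OF A], simplified comp_apply]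
  interpret S1: bounded_linear S1 using assms(4) by (rule A_bounded_bounded_linear)
  interpret S2: bounded_linear S2 using assms(5) by (rule A_bounded_bounded_linear)
  obtain v w where vw: "v > 0" "w > 0"
    and vwa: "v * ?a + w * ?c \<le> r * v" and vwb: "v * ?b + w * ?d \<le> r * w"
    using positive_matrix_subeigenvector[OF nonneg(1,2,3,4) r] by blast
  have "r > 0"
  proof -
    have "0 \<le> 1/2 * (?a + ?d + sqrt ((?a - ?d)\<^sup>2 + 4 * ?b * ?c))"
      using nonneg by (intro mult_nonneg_nonneg add_nonneg_nonneg) simp_all
    with r show ?thesis
      by (rule le_less_trans[rotated])
  qed
  \<comment> \<open>The weights turn the matrix inequality into a single scalar one: each
    application of \<open>?R\<close> multiplies \<open>f\<close> by at most
    \<open>r\<close>.\<close>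
  define f where "f x = v * ?N (S1 x) + w * ?N (S2 x)" for x
  have step: "f (?R y) \<le> r * f y" for y
  proof -
    have "?N (S1 (?R y)) \<le> ?a * ?N (S1 y) + ?b * ?N (S2 y)"
      using A_norm_triangle[OF A, of "S1 (T1 (S1 y))" "S1 (T2 (S2 y))"]
        opnorm(1)[of "S1 y"] opnorm(2)[of "S2 y"] by (simp add: S1.add)
    moreover have "?N (S2 (?R y)) \<le> ?c * ?N (S1 y) + ?d * ?N (S2 y)"
      using A_norm_triangle[OF A, of "S2 (T1 (S1 y))" "S2 (T2 (S2 y))"]
        opnorm(3)[of "S1 y"] opnorm(4)[of "S2 y"] by (simp add: S2.add)
    ultimately have "f (?R y) \<le> v * (?a * ?N (S1 y) + ?b * ?N (S2 y))
        + w * (?c * ?N (S1 y) + ?d * ?N (S2 y))"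
      unfolding f_def using vw by (intro add_mono mult_left_mono) auto
    also have "\<dots> = (v * ?a + w * ?c) * ?N (S1 y) + (v * ?b + w * ?d) * ?N (S2 y)"
      by (simp add: algebra_simps)
    also have "\<dots> \<le> (r * v) * ?N (S1 y) + (r * w) * ?N (S2 y)"
      using vwa vwb A_norm_nonneg[OF A] by (intro add_mono mult_right_mono) auto
    also have "\<dots> = r * f y"
      by (simp add: f_def algebra_simps)
    finally show ?thesis .
  qed
  have iterate: "f ((?R ^^ n) x) \<le> r ^ n * f x" for n x
  proof (induction n)
    case (Suc n)
    have "f ((?R ^^ Suc n) x) \<le> r * f ((?R ^^ n) x)"
      using step by simp
    also have "\<dots> \<le> r * (r ^ n * f x)"
      using Suc \<open>r > 0\<close> by (intro mult_left_mono) auto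
    finally show ?case
      by simp
  qed simp
  obtain t1 where t1: "t1 > 0" "\<And>x. ?N (T1 x) \<le> t1 * ?N x"
    using assms(2) unfolding A_bounded_def by blast
  obtain t2 where t2: "t2 > 0" "\<And>x. ?N (T2 x) \<le> t2 * ?N x"
    using assms(3) unfolding A_bounded_def by blast
  obtain s1 where s1: "s1 > 0" "\<And>x. ?N (S1 x) \<le> s1 * ?N x"
    using assms(4) unfolding A_bounded_def by blast
  obtain s2 where s2: "s2 > 0" "\<And>x. ?N (S2 x) \<le> s2 * ?N x"
    using assms(5) unfolding A_bounded_def by blast
  \<comment> \<open>\<open>C\<close> and \<open>D\<close> compare \<open>f\<close> with the
    seminorm: \<open>f\<close> is at most \<open>D\<close> times it, while the reverse comparison
    holds only after one application of \<open>?R\<close>. Dividing by \<open>v\<close> and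
    \<open>w\<close> undoes the weights.\<close>
  define C where "C = t1 / v + t2 / w"
  define D where "D = v * s1 + w * s2"
  have "C > 0" "D > 0"
    using t1(1) t2(1) s1(1) s2(1) vw by (simp_all add: C_def D_def add_pos_pos)
  have R_le: "?N (?R y) \<le> C * f y" for y
  proof -
    have "?N (?R y) \<le> t1 * ?N (S1 y) + t2 * ?N (S2 y)"
      using A_norm_triangle[OF A, of "T1 (S1 y)" "T2 (S2 y)"] t1(2)[of "S1 y"] t2(2)[of "S2 y"]
      by simp
    also have "\<dots> = t1 / v * (v * ?N (S1 y)) + t2 / w * (w * ?N (S2 y))"
      using vw by simp
    also have "\<dots> \<le> t1 / v * f y + t2 / w * f y"
      unfolding f_def using vw t1(1) t2(1) A_norm_nonneg[OF A]
      by (intro add_mono mult_left_mono) auto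
    finally show ?thesis
      by (simp add: C_def algebra_simps)
  qed
  have f_le: "f x \<le> D * ?N x" for x
  proof -
    have "f x \<le> v * (s1 * ?N x) + w * (s2 * ?N x)"
      unfolding f_def using vw s1(2) s2(2) by (intro add_mono mult_left_mono) auto
    then show ?thesis
      by (simp add: D_def algebra_simps)
  qed
  \<comment> \<open>The outermost \<open>?R\<close> is used by \<open>R_le\<close> to return from
    \<open>f\<close> to the seminorm, so only \<open>n\<close> factors of \<open>r\<close>
    remain.\<close>
  have "?N ((?R ^^ Suc n) x) \<le> C * D * r ^ n * ?N x" for n x
  proof -
    have "?N ((?R ^^ Suc n) x) \<le> C * f ((?R ^^ n) x)"
      using R_le by simp
    also have "\<dots> \<le> C * (r ^ n * (D * ?N x))"
      using \<open>C > 0\<close> \<open>r > 0\<close>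
      by (intro mult_left_mono order_trans[OF iterate] f_le) auto
    finally show ?thesis
      by (simp add: mult_ac)
  qed
  then show "A_spectral_radius A ?R \<le> r"
    using A_spectral_radius_le[OF A, of "C * D" r ?R] \<open>C > 0\<close> \<open>D > 0\<close> \<open>r > 0\<close> by simp
qed

end
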